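(* Let $G$ be a connected graph on $n\ge 2$ vertices, and let $G^c$ be its complement. Then $$\frac12 < b(G)+b(G^c)\le \frac n2.$$ The equality on the right side holds if and only if $G\cong K_n$.
   Context: Graphs are finite, simple, undirected and unweighted. For a graph $G$ with vertex set $V(G)$, $|V(G)|=n\ge 2$, and edge set $E(G)$ (not necessarily connected), the $\ell_1$-Fiedler value is $$b(G)=\min\Big\{\sum_{uv\in E(G)}|x_u-x_v| : x\in\mathbb{R}^{V(G)},\ \sum_{v\in V(G)}x_v=0,\ \sum_{v\in V(G)}|x_v|=1\Big\}.$$ The complement $G^c$ has vertex set $V(G)$, two distinct vertices being adjacent in $G^c$ if and only if they are not adjacent in $G$. $K_n$ is the complete graph on $n$ vertices. *)

theory Defs
  imports Complex_Main "Graph_Theory.Graph_Theory"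
begin

text \<open>
  Finite simple undirected graphs are the \<^locale>\<open>pair_graph\<close>s of the Graph_Theory library, that is
  finite, loop-free, symmetric digraphs without parallel arcs: an edge uv is represented by the two
  arcs (u, v) and (v, u).
\<close>

definition complement_graph :: "'a pair_pre_digraph \<Rightarrow> 'a pair_pre_digraph" where
  "complement_graph G =
     \<lparr> pverts = pverts G,
       parcs = {(u, v). u \<in> pverts G \<and> v \<in> pverts G \<and> u \<noteq> v \<and> (u, v) \<notin> parcs G} \<rparr>"

definition complete_graph :: "nat \<Rightarrow> nat pair_pre_digraph" where
  "complete_graph n = \<lparr> pverts = {..<n}, parcs = {(i, j). i < n \<and> j < n \<and> i \<noteq> j} \<rparr>"

text \<open>
  The sum of |x u - x v| over the undirected edges uv. Each edge contributes two arcs with the same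
  summand, hence the factor 1/2; the lemma below confirms that the result is the sum with every
  edge taken once.
\<close>

definition edge_variation :: "'a pair_pre_digraph \<Rightarrow> ('a \<Rightarrow> real) \<Rightarrow> real" where
  "edge_variation G x = (\<Sum>(u, v)\<in>parcs G. \<bar>x u - x v\<bar>) / 2"

lemma edge_variation_orientation:
  assumes "pair_graph G" and "parcs G = F \<union> F\<inverse>" and "F \<inter> F\<inverse> = {}"
  shows "edge_variation G x = (\<Sum>(u, v)\<in>F. \<bar>x u - x v\<bar>)"
proof -
  interpret pair_graph G by fact
  have fin: "finite F" "finite (F\<inverse>)"
    using pair_finite_arcs assms(2) by (auto intro: finite_subset)
  have "(\<Sum>(u, v)\<in>F\<inverse>. \<bar>x u - x v\<bar>) = (\<Sum>(u, v)\<in>F. \<bar>x u - x v\<bar>)"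
    by (rule sum.reindex_bij_witness[of _ prod.swap prod.swap]) auto
  then show ?thesis
    using sum.union_disjoint[OF fin assms(3), of "\<lambda>(u, v). \<bar>x u - x v\<bar>"] assms(2)
    by (simp add: edge_variation_def)
qed

text \<open>
  The minimum is the least element of the set of attained values; for at least two vertices it
  exists by compactness. Only the values of x on the vertices matter.
\<close>

definition l1_fiedler :: "'a pair_pre_digraph \<Rightarrow> real" where
  "l1_fiedler G =
     (LEAST r. \<exists>x. (\<Sum>v\<in>pverts G. x v) = 0 \<and> (\<Sum>v\<in>pverts G. \<bar>x v\<bar>) = 1 \<and> r = edge_variation G x)"

end

theory Submission
  imports Defs "HOL-Library.Indicator_Function"
begin

text \<open>
  The edge variation splits as the variation of the positive part plus that of the negative part of x,
  and by a layer-cake argument each of the two is at least its mass times cut(A)/|A| for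
  some superlevel set A.
  Hence b(G) is the least value of (cut(A)/|A| + cut(B)/|B|)/2 over disjoint nonempty A and B.

  For the lower bound, take minimizing pairs (A, B) for G and (C, D) for the complement with
  |A|, |C| at most n/2. A pair of vertices separated both by A and by C is an edge of G or of the
  complement, and therefore counts in one of the two cuts; this forces
  cut(A)/|A| + cut(C)/|C| to be at least 1. Connectedness makes cut(B) positive.

  For the upper bound, use one bipartition for both graphs. Equality forces the cut of
  every bipartition of G to be optimal, so the cuts of singletons are all equal and those of
  pairs are all equal; since
  cut({u, v}) = cut({u}) + cut({v}) - 2 [uv is an edge], all pairs are edges as soon as one is.
\<close>

section \<open>Edge variation\<close>

lemma edge_variation_nonneg: "0 \<le> edge_variation G x"
  by (auto simp: edge_variation_def intro!: sum_nonneg)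

lemma edge_variation_cong:
  assumes "\<And>u v. (u, v) \<in> parcs G \<Longrightarrow> \<bar>x u - x v\<bar> = \<bar>y u - y v\<bar>"
  shows "edge_variation G x = edge_variation G y"
  using assms unfolding edge_variation_def by (auto intro!: sum.cong)

lemma edge_variation_add:
  assumes "\<And>u v. (u, v) \<in> parcs G \<Longrightarrow> \<bar>x u - x v\<bar> = \<bar>y u - y v\<bar> + \<bar>z u - z v\<bar>"
  shows "edge_variation G x = edge_variation G y + edge_variation G z"
proof -
  have "(\<Sum>(u, v)\<in>parcs G. \<bar>x u - x v\<bar>) = (\<Sum>(u, v)\<in>parcs G. \<bar>y u - y v\<bar> + \<bar>z u - z v\<bar>)"
    using assms by (auto intro!: sum.cong)
  then show ?thesis
    by (simp add: edge_variation_def case_prod_unfold sum.distrib add_divide_distrib)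
qed

lemma edge_variation_scale: "edge_variation G (\<lambda>v. c * x v) = \<bar>c\<bar> * edge_variation G x"
  by (simp add: edge_variation_def case_prod_unfold sum_distrib_left abs_mult
      flip: right_diff_distrib)

definition cut_ratio :: "'a pair_pre_digraph \<Rightarrow> 'a set \<Rightarrow> real" where
  "cut_ratio G A = edge_variation G (indicator A) / real (card A)"

lemma cut_ratio_nonneg: "0 \<le> cut_ratio G A"
  by (simp add: cut_ratio_def edge_variation_nonneg)

lemma sum_indicator_subset:
  assumes "finite V" "A \<subseteq> V"
  shows "(\<Sum>v\<in>V. c * indicator A v) = (c :: real) * real (card A)"
  using assms by (simp add: sum_distrib_left[symmetric] indicator_def sum.If_cases Int_absorb1 Int_def[symmetric])

lemma (in pair_fin_digraph) layer_cake_bound: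
  assumes "\<And>v. v \<in> pverts G \<Longrightarrow> 0 \<le> y v"
    and "\<And>A. A \<noteq> {} \<Longrightarrow> A \<subseteq> {v \<in> pverts G. 0 < y v} \<Longrightarrow>
      c * real (card A) \<le> edge_variation G (indicator A)"
  shows "c * (\<Sum>v\<in>pverts G. y v) \<le> edge_variation G y"
  using assms
proof (induction "card {v \<in> pverts G. 0 < y v}" arbitrary: y rule: less_induct)
  case less
  define S where "S = {v \<in> pverts G. 0 < y v}"
  have fin: "finite S" using pair_finite_verts by (simp add: S_def)
  have zero: "y v = 0" if "v \<in> pverts G" "v \<notin> S" for v
    using that less.prems(1)[of v] by (auto simp: S_def)
  show ?case
  proof (cases "S = {}")
    case True
    then show ?thesis using zero edge_variation_nonneg[of G y] by simp
  next
    case False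
    define m where "m = Min (y ` S)"
    have m_le: "m \<le> y v" if "v \<in> S" for v using that fin by (simp add: m_def)
    have "m \<in> y ` S" using Min_in[of "y ` S"] fin False by (simp add: m_def)
    then obtain w where w: "w \<in> S" "y w = m" by blast
    have m_pos: "0 < m" using w by (auto simp: S_def)
    define z where "z v = y v - m * indicator S v" for v
    have z_nonneg: "0 \<le> z v" if "v \<in> pverts G" for v
      using m_le less.prems(1)[OF that] by (auto simp: z_def indicator_def)
    have sub: "{v \<in> pverts G. 0 < z v} \<subseteq> S - {w}"
    proof
      fix v assume v: "v \<in> {v \<in> pverts G. 0 < z v}"
      then have "v \<in> S" using zero[of v] by (cases "v \<in> S") (auto simp: z_def)
      with v w show "v \<in> S - {w}" by (auto simp: z_def)
    qed
    have "card {v \<in> pverts G. 0 < z v} < card S"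
      using card_mono[OF _ sub] fin card_Diff1_less[OF fin w(1)] by simp
    then have z_le: "c * (\<Sum>v\<in>pverts G. z v) \<le> edge_variation G z"
    proof (intro less.hyps)
      show "c * real (card A) \<le> edge_variation G (indicator A)"
        if "A \<noteq> {}" "A \<subseteq> {v \<in> pverts G. 0 < z v}" for A
        using that sub unfolding S_def by (intro less.prems(2)) blast+
    qed (simp_all add: S_def z_nonneg)
    have S_le: "m * (c * real (card S)) \<le> m * edge_variation G (indicator S)"
      using less.prems(2)[of S] False m_pos by (intro mult_left_mono) (auto simp: S_def)
    have ev_y: "edge_variation G y = edge_variation G z + edge_variation G (\<lambda>v. m * indicator S v)"
    proof (rule edge_variation_add)
      fix u v assume "(u, v) \<in> parcs G"
      then have "u \<in> pverts G" "v \<in> pverts G" by (auto dest: wellformed')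
      then show "\<bar>y u - y v\<bar> = \<bar>z u - z v\<bar> + \<bar>m * indicator S u - m * indicator S v\<bar>"
        using zero[of u] zero[of v] m_le[of u] m_le[of v] m_pos
        by (auto simp: z_def indicator_def)
    qed
    have sum_y: "(\<Sum>v\<in>pverts G. y v) = (\<Sum>v\<in>pverts G. z v) + m * real (card S)"
    proof -
      have "(\<Sum>v\<in>pverts G. m * indicator S v) = m * real (card S)"
        using pair_finite_verts by (intro sum_indicator_subset) (auto simp: S_def)
      then show ?thesis by (simp add: z_def sum_subtractf del: sum_mult_indicator)
    qed
    have "c * (\<Sum>v\<in>pverts G. y v) = c * (\<Sum>v\<in>pverts G. z v) + m * (c * real (card S))"
      by (simp add: sum_y algebra_simps)
    also have "\<dots> \<le> edge_variation G z + m * edge_variation G (indicator S)"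
      by (rule add_mono[OF z_le S_le])
    also have "\<dots> = edge_variation G y"
      using m_pos by (simp add: ev_y edge_variation_scale)
    finally show ?thesis .
  qed
qed

lemma (in pair_fin_digraph) superlevel_cut_ratio:
  assumes nonneg: "\<And>v. v \<in> pverts G \<Longrightarrow> 0 \<le> y v" and pos: "0 < (\<Sum>v\<in>pverts G. y v)"
  obtains A where "A \<noteq> {}" "A \<subseteq> {v \<in> pverts G. 0 < y v}"
    "cut_ratio G A * (\<Sum>v\<in>pverts G. y v) \<le> edge_variation G y"
proof -
  define S where "S = {v \<in> pverts G. 0 < y v}"
  have fin: "finite S" using pair_finite_verts by (simp add: S_def)
  have "S \<noteq> {}"
  proof
    assume "S = {}"
    then have "(\<Sum>v\<in>pverts G. y v) \<le> 0" by (intro sum_nonpos) (auto simp: S_def not_less)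
    with pos show False by simp
  qed
  then have "Pow S - {{}} \<noteq> {}" by auto
  with fin obtain A where A: "A \<in> Pow S - {{}}"
    and le: "\<And>B. B \<in> Pow S - {{}} \<Longrightarrow> cut_ratio G A \<le> cut_ratio G B"
    using ex_is_arg_min_if_finite[of "Pow S - {{}}" "cut_ratio G"]
    by (auto simp: is_arg_min_linorder)
  show thesis
  proof (rule that)
    show "cut_ratio G A * (\<Sum>v\<in>pverts G. y v) \<le> edge_variation G y"
    proof (rule layer_cake_bound)
      fix B assume B: "B \<noteq> {}" "B \<subseteq> {v \<in> pverts G. 0 < y v}"
      then have "0 < card B" using fin by (auto simp: S_def card_gt_0_iff intro: finite_subset)
      with le[of B] B show "cut_ratio G A * real (card B) \<le> edge_variation G (indicator B)"
        by (simp add: S_def cut_ratio_def[of _ B] field_simps)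
    qed (rule nonneg)
  qed (use A in \<open>auto simp: S_def\<close>)
qed

section \<open>The combinatorial form of the Fiedler value\<close>

lemma (in pair_fin_digraph) two_set_vector:
  assumes "A \<noteq> {}" "A \<subseteq> pverts G" "B \<noteq> {}" "B \<subseteq> pverts G" "A \<inter> B = {}"
  obtains x where "(\<Sum>v\<in>pverts G. x v) = 0" "(\<Sum>v\<in>pverts G. \<bar>x v\<bar>) = 1"
    "edge_variation G x = (cut_ratio G A + cut_ratio G B) / 2"
proof -
  define a where "a = 1 / (2 * real (card A))"
  define b where "b = 1 / (2 * real (card B))"
  have "finite A" "finite B" using assms pair_finite_verts by (auto intro: finite_subset)
  then have card: "0 < card A" "0 < card B" using assms by (auto simp: card_gt_0_iff)
  then have ab: "0 < a" "0 < b" "a * real (card A) = 1 / 2" "b * real (card B) = 1 / 2"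
    by (auto simp: a_def b_def)
  define x where "x v = a * indicator A v - b * indicator B v" for v
  show thesis
  proof (rule that)
    show "(\<Sum>v\<in>pverts G. x v) = 0"
      using assms pair_finite_verts ab
      by (simp add: x_def sum_subtractf sum_indicator_subset del: sum_mult_indicator sum_indicator_eq_card)
    have "\<bar>x v\<bar> = a * indicator A v + b * indicator B v" for v
      using assms ab by (auto simp: x_def indicator_def)
    then show "(\<Sum>v\<in>pverts G. \<bar>x v\<bar>) = 1"
      using assms pair_finite_verts ab
      by (simp add: sum.distrib sum_indicator_subset del: sum_mult_indicator sum_indicator_eq_card)
    have "edge_variation G x = edge_variation G (\<lambda>v. a * indicator A v) +
        edge_variation G (\<lambda>v. b * indicator B v)"
      by (rule edge_variation_add) (use assms ab in \<open>auto simp: x_def indicator_def\<close>)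
    then show "edge_variation G x = (cut_ratio G A + cut_ratio G B) / 2"
      using ab by (simp add: edge_variation_scale[of G a] edge_variation_scale[of G b])
        (simp add: cut_ratio_def a_def b_def field_simps)
  qed
qed

lemma (in pair_fin_digraph) two_set_lower_bound:
  assumes x: "(\<Sum>v\<in>pverts G. x v) = 0" "(\<Sum>v\<in>pverts G. \<bar>x v\<bar>) = 1"
  obtains A B where "A \<noteq> {}" "A \<subseteq> pverts G" "B \<noteq> {}" "B \<subseteq> pverts G" "A \<inter> B = {}"
    "(cut_ratio G A + cut_ratio G B) / 2 \<le> edge_variation G x"
proof -
  define p where "p v = max (x v) 0" for v
  define q where "q v = max (- x v) 0" for v
  have "x v = p v - q v" "\<bar>x v\<bar> = p v + q v" for v by (auto simp: p_def q_def)
  then have pq: "(\<Sum>v\<in>pverts G. p v) = 1 / 2" "(\<Sum>v\<in>pverts G. q v) = 1 / 2"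
    using x by (auto simp: sum_subtractf sum.distrib)
  have ev: "edge_variation G x = edge_variation G p + edge_variation G q"
    by (rule edge_variation_add) (auto simp: p_def q_def)
  obtain A where A: "A \<noteq> {}" "A \<subseteq> {v \<in> pverts G. 0 < p v}"
      "cut_ratio G A * (\<Sum>v\<in>pverts G. p v) \<le> edge_variation G p"
    by (rule superlevel_cut_ratio[of p]) (auto simp: p_def pq[unfolded p_def])
  obtain B where B: "B \<noteq> {}" "B \<subseteq> {v \<in> pverts G. 0 < q v}"
      "cut_ratio G B * (\<Sum>v\<in>pverts G. q v) \<le> edge_variation G q"
    by (rule superlevel_cut_ratio[of q]) (auto simp: q_def pq[unfolded q_def])
  show thesis
  proof (rule that)
    show "A \<inter> B = {}" using A(2) B(2) by (force simp: p_def q_def)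
    show "(cut_ratio G A + cut_ratio G B) / 2 \<le> edge_variation G x"
      using A(3) B(3) by (simp add: ev pq)
  qed (use A B in auto)
qed

lemma (in pair_fin_digraph) l1_fiedler_two_sets:
  assumes "2 \<le> card (pverts G)"
  shows "\<exists>A B. A \<noteq> {} \<and> A \<subseteq> pverts G \<and> B \<noteq> {} \<and> B \<subseteq> pverts G \<and> A \<inter> B = {} \<and>
      card A \<le> card B \<and> l1_fiedler G = (cut_ratio G A + cut_ratio G B) / 2" (is ?attained)
    and "(\<Sum>v\<in>pverts G. x v) = 0 \<Longrightarrow> (\<Sum>v\<in>pverts G. \<bar>x v\<bar>) = 1 \<Longrightarrow>
      l1_fiedler G \<le> edge_variation G x"
proof -
  define P where "P = {(A, B). A \<noteq> {} \<and> A \<subseteq> pverts G \<and> B \<noteq> {} \<and> B \<subseteq> pverts G \<and> A \<inter> B = {}}"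
  define val where "val = (\<lambda>(A, B). (cut_ratio G A + cut_ratio G B) / 2)"
  have "P \<subseteq> Pow (pverts G) \<times> Pow (pverts G)" by (auto simp: P_def)
  then have "finite P" using pair_finite_verts by (meson finite_Pow_iff finite_SigmaI finite_subset)
  moreover have "P \<noteq> {}"
  proof -
    obtain u v where "u \<in> pverts G" "v \<in> pverts G" "u \<noteq> v"
      using assms card_le_Suc0_iff_eq[OF pair_finite_verts] by fastforce
    then have "({u}, {v}) \<in> P" by (auto simp: P_def)
    then show ?thesis by blast
  qed
  ultimately obtain AB where AB: "AB \<in> P" and min: "\<And>Q. Q \<in> P \<Longrightarrow> val AB \<le> val Q"
    using ex_is_arg_min_if_finite[of P val] by (auto simp: is_arg_min_linorder)
  obtain A B where [simp]: "AB = (A, B)" by (cases AB)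
  have lower: "val (A, B) \<le> edge_variation G y"
    if "(\<Sum>v\<in>pverts G. y v) = 0" "(\<Sum>v\<in>pverts G. \<bar>y v\<bar>) = 1" for y
  proof -
    obtain C D where "C \<noteq> {}" "C \<subseteq> pverts G" "D \<noteq> {}" "D \<subseteq> pverts G" "C \<inter> D = {}"
      "(cut_ratio G C + cut_ratio G D) / 2 \<le> edge_variation G y"
      by (rule two_set_lower_bound[OF \<open>(\<Sum>v\<in>pverts G. y v) = 0\<close> \<open>(\<Sum>v\<in>pverts G. \<bar>y v\<bar>) = 1\<close>])
    with min[of "(C, D)"] show ?thesis by (simp add: P_def val_def)
  qed
  obtain y where "(\<Sum>v\<in>pverts G. y v) = 0" "(\<Sum>v\<in>pverts G. \<bar>y v\<bar>) = 1"
      "edge_variation G y = val (A, B)"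
    by (rule two_set_vector[of A B]) (use AB in \<open>auto simp: P_def val_def\<close>)
  then have eq: "l1_fiedler G = val (A, B)"
    unfolding l1_fiedler_def by (intro Least_equality) (auto intro: lower exI[of _ y])
  show "l1_fiedler G \<le> edge_variation G x"
    if "(\<Sum>v\<in>pverts G. x v) = 0" "(\<Sum>v\<in>pverts G. \<bar>x v\<bar>) = 1"
    using lower[OF that] eq by simp
  show ?attained
  proof (cases "card A \<le> card B")
    case True
    then show ?thesis
      using AB eq by (intro exI[of _ A] exI[of _ B]) (auto simp: P_def val_def)
  next
    case False
    then show ?thesis
      using AB eq by (intro exI[of _ B] exI[of _ A]) (auto simp: P_def val_def add.commute)
  qed
qed

lemma (in pair_fin_digraph) l1_fiedler_nonneg:
  assumes "2 \<le> card (pverts G)"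
  shows "0 \<le> l1_fiedler G"
proof -
  obtain A B where "l1_fiedler G = (cut_ratio G A + cut_ratio G B) / 2"
    using l1_fiedler_two_sets(1)[OF assms] by blast
  then show ?thesis using cut_ratio_nonneg[of G A] cut_ratio_nonneg[of G B] by argo
qed

lemma (in pair_fin_digraph) l1_fiedler_le_cut:
  assumes "A \<noteq> {}" "A \<subset> pverts G"
  shows "l1_fiedler G \<le> edge_variation G (indicator A) * real (card (pverts G)) /
    (2 * real (card A) * (real (card (pverts G)) - real (card A)))"
proof -
  define B where "B = pverts G - A"
  have fin: "finite A" "finite B"
    using assms pair_finite_verts by (auto simp: B_def intro: finite_subset)
  have "0 < card A" "0 < card B" using fin assms by (auto simp: B_def card_gt_0_iff)
  moreover have n: "card (pverts G) = card A + card B"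
    using assms pair_finite_verts fin by (simp add: B_def card_Diff_subset card_mono psubset_imp_subset)
  ultimately have "2 \<le> card (pverts G)" by linarith
  obtain x where x: "(\<Sum>v\<in>pverts G. x v) = 0" "(\<Sum>v\<in>pverts G. \<bar>x v\<bar>) = 1"
      "edge_variation G x = (cut_ratio G A + cut_ratio G B) / 2"
    by (rule two_set_vector[of A B]) (use assms in \<open>auto simp: B_def\<close>)
  have "edge_variation G (indicator B) = edge_variation G (indicator A)"
    by (rule edge_variation_cong) (auto simp: B_def indicator_def dest: wellformed')
  then have "edge_variation G x = edge_variation G (indicator A) * (1 / card A + 1 / card B) / 2"
    by (simp add: x(3) cut_ratio_def field_simps)
  also have "\<dots> = edge_variation G (indicator A) * real (card (pverts G)) /
      (2 * real (card A) * (real (card (pverts G)) - real (card A)))"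
    using \<open>0 < card A\<close> \<open>0 < card B\<close> by (simp add: n field_simps)
  finally show ?thesis
    using l1_fiedler_two_sets(2)[OF \<open>2 \<le> card (pverts G)\<close> x(1,2)] by simp
qed

section \<open>A graph and its complement\<close>

lemma complement_graph_simps [simp]:
  "pverts (complement_graph G) = pverts G"
  "(u, v) \<in> parcs (complement_graph G) \<longleftrightarrow>
    u \<in> pverts G \<and> v \<in> pverts G \<and> u \<noteq> v \<and> (u, v) \<notin> parcs G"
  by (auto simp: complement_graph_def)

lemma (in pair_fin_digraph) pair_fin_digraph_complement: "pair_fin_digraph (complement_graph G)"
proof
  have "parcs (complement_graph G) \<subseteq> pverts G \<times> pverts G" by auto
  then show "finite (parcs (complement_graph G))"
    using pair_finite_verts by (meson finite_SigmaI finite_subset)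
qed (use pair_finite_verts in auto)

lemma (in pair_fin_digraph) edge_variation_complement:
  "edge_variation G x + edge_variation (complement_graph G) y =
    (\<Sum>(u, v)\<in>pverts G \<times> pverts G. if (u, v) \<in> parcs G then \<bar>x u - x v\<bar> else \<bar>y u - y v\<bar>) / 2"
proof -
  let ?V = "pverts G \<times> pverts G"
  let ?f = "\<lambda>(u, v). if (u, v) \<in> parcs G then \<bar>x u - x v\<bar> else \<bar>y u - y v\<bar>"
  have fin: "finite ?V" using pair_finite_verts by simp
  have sub: "parcs G \<subseteq> ?V" by (auto dest: wellformed')
  have "sum ?f ?V = sum ?f (?V - parcs G) + sum ?f (parcs G)"
    by (rule sum.subset_diff[OF sub fin])
  also have "sum ?f (?V - parcs G) = sum ?f (parcs (complement_graph G))"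
    by (rule sum.mono_neutral_right) (use fin in auto)
  also have "\<dots> = (\<Sum>(u, v)\<in>parcs (complement_graph G). \<bar>y u - y v\<bar>)"
    by (rule sum.cong) auto
  also have "sum ?f (parcs G) = (\<Sum>(u, v)\<in>parcs G. \<bar>x u - x v\<bar>)"
    by (rule sum.cong) auto
  finally show ?thesis by (simp add: edge_variation_def)
qed

lemma sum_indicator_Times:
  assumes "finite V" "A \<subseteq> V" "B \<subseteq> V"
  shows "(\<Sum>(u, v)\<in>V \<times> V. indicator A u * indicator B v) = real (card A) * real (card B)"
proof -
  have "(\<Sum>(u, v)\<in>V \<times> V. indicator A u * indicator B v) =
      (\<Sum>u\<in>V. \<Sum>v\<in>V. indicator A u * indicator B v :: real)"
    by (rule sum.cartesian_product[symmetric])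
  also have "\<dots> = (\<Sum>u\<in>V. indicator A u) * (\<Sum>v\<in>V. indicator B v)"
    by (rule sum_product[symmetric])
  finally show ?thesis
    using sum_indicator_subset[of V A 1] sum_indicator_subset[of V B 1] assms by simp
qed

lemma (in pair_fin_digraph) cut_complement:
  assumes "A \<subseteq> pverts G"
  shows "edge_variation G (indicator A) + edge_variation (complement_graph G) (indicator A) =
    real (card A) * (real (card (pverts G)) - real (card A))"
proof -
  let ?V = "pverts G"
  have "(\<Sum>(u, v)\<in>?V \<times> ?V. if (u, v) \<in> parcs G then \<bar>indicator A u - indicator A v\<bar>
        else \<bar>indicator A u - indicator A v\<bar>) =
      (\<Sum>(u, v)\<in>?V \<times> ?V. (indicator A u * indicator (?V - A) v + indicator (?V - A) u * indicator A v :: real))"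
    by (rule sum.cong) (auto simp: indicator_def)
  also have "\<dots> = 2 * (real (card A) * real (card (?V - A)))"
    using sum_indicator_Times[of ?V A "?V - A"] sum_indicator_Times[of ?V "?V - A" A]
      assms pair_finite_verts
    by (simp add: case_prod_unfold sum.distrib)
  also have "real (card (?V - A)) = real (card ?V) - real (card A)"
    using assms pair_finite_verts by (simp add: card_Diff_subset finite_subset card_mono of_nat_diff)
  finally show ?thesis by (simp add: edge_variation_complement)
qed

lemma (in pair_fin_digraph) crossing_pairs_le:
  assumes "A \<subseteq> pverts G" "C \<subseteq> pverts G"
  shows "real (card (A \<inter> C)) * real (card (pverts G - (A \<union> C))) +
      real (card (A - C)) * real (card (C - A)) \<le>
    edge_variation G (indicator A) + edge_variation (complement_graph G) (indicator C)"
proof -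
  let ?V = "pverts G"
  define P Q R S where sets: "P = A \<inter> C" "Q = A - C" "R = C - A" "S = ?V - (A \<union> C)"
  have sub: "P \<subseteq> ?V" "Q \<subseteq> ?V" "R \<subseteq> ?V" "S \<subseteq> ?V" using assms by (auto simp: sets)
  have "2 * (real (card P) * real (card S) + real (card Q) * real (card R)) =
      (\<Sum>(u, v)\<in>?V \<times> ?V. indicator P u * indicator S v + indicator S u * indicator P v +
        (indicator Q u * indicator R v + indicator R u * indicator Q v))"
    using sub pair_finite_verts sum_indicator_Times[of ?V P S] sum_indicator_Times[of ?V S P]
      sum_indicator_Times[of ?V Q R] sum_indicator_Times[of ?V R Q]
    by (simp add: case_prod_unfold sum.distrib)
  also have "\<dots> \<le> (\<Sum>(u, v)\<in>?V \<times> ?V. if (u, v) \<in> parcs G then \<bar>indicator A u - indicator A v\<bar>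
        else \<bar>indicator C u - indicator C v\<bar>)"
    by (rule sum_mono) (auto simp: sets indicator_def)
  finally show ?thesis by (simp add: edge_variation_complement sets)
qed

lemma max_le_crossing:
  fixes p q r s :: nat
  assumes "p + q \<le> r + s" "p + r \<le> q + s" "0 < p + q" "0 < p + r"
  shows "max (p + q) (p + r) \<le> p * s + q * r"
proof -
  have ps: "p \<le> p * s" using assms by (cases s) auto
  consider "q = 0" | "r = 0" | "0 < q" "0 < r" by blast
  then show ?thesis
  proof cases
    case 1
    then have "s \<le> p * s" using assms by simp
    then have "max (p + q) (p + r) \<le> p * s" using 1 assms ps by linarith
    then show ?thesis by simp
  next
    case 2
    then have "s \<le> p * s" using assms by simp
    then have "max (p + q) (p + r) \<le> p * s" using 2 assms ps by linarith
    then show ?thesis by simp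
  next
    case 3
    then have "q \<le> q * r" "r \<le> q * r" by auto
    then show ?thesis using ps by (intro max.boundedI add_mono)
  qed
qed

lemma (in pair_fin_digraph) cut_ratio_complement:
  assumes "A \<noteq> {}" "A \<subseteq> pverts G" "2 * card A \<le> card (pverts G)"
    and "C \<noteq> {}" "C \<subseteq> pverts G" "2 * card C \<le> card (pverts G)"
  shows "1 \<le> cut_ratio G A + cut_ratio (complement_graph G) C"
proof -
  define p q r s where sets: "p = card (A \<inter> C)" "q = card (A - C)" "r = card (C - A)"
    "s = card (pverts G - (A \<union> C))"
  have fin: "finite A" "finite C" using assms pair_finite_verts by (auto intro: finite_subset)
  have A: "card A = p + q" and C: "card C = p + r"
    using fin card_Int_Diff[of A C] card_Int_Diff[of C A] by (auto simp: sets Int_commute)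
  have "card (pverts G) = card (A \<union> C) + s"
    using fin assms pair_finite_verts card_mono[of "pverts G" "A \<union> C"]
    by (simp add: sets card_Diff_subset)
  moreover have "card (A \<union> C) + p = card A + card C"
    using card_Un_Int[OF fin] by (simp add: sets)
  ultimately have n: "card (pverts G) = p + q + r + s" using A C by simp
  have pos: "0 < card A" "0 < card C" using fin assms by (auto simp: card_gt_0_iff)
  have "max (p + q) (p + r) \<le> p * s + q * r"
    using assms(3,6) pos by (intro max_le_crossing) (auto simp: A C n)
  then have "real (max (card A) (card C)) \<le> real p * real s + real q * real r"
    unfolding A C by (metis of_nat_add of_nat_le_iff of_nat_mult)
  also have "\<dots> \<le> edge_variation G (indicator A) + edge_variation (complement_graph G) (indicator C)"
    unfolding sets by (rule crossing_pairs_le) (use assms in auto)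
  also have "\<dots> = cut_ratio G A * real (card A) + cut_ratio (complement_graph G) C * real (card C)"
    using pos by (simp add: cut_ratio_def)
  also have "\<dots> \<le> (cut_ratio G A + cut_ratio (complement_graph G) C) * real (max (card A) (card C))"
    unfolding distrib_right by (intro add_mono mult_left_mono cut_ratio_nonneg) auto
  finally show ?thesis using pos by (simp add: mult_le_cancel_right1)
qed

lemma (in pair_fin_digraph) cut_pos_if_connected:
  assumes conn: "Digraph_Component.connected (with_proj G)" and B: "B \<noteq> {}" "B \<subset> pverts G"
  shows "0 < edge_variation G (indicator B)"
proof (rule ccontr)
  assume "\<not> 0 < edge_variation G (indicator B)"
  then have "(\<Sum>(u, v)\<in>parcs G. \<bar>indicator B u - indicator B v :: real\<bar>) = 0"
    using edge_variation_nonneg[of G "indicator B"] by (simp add: edge_variation_def)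
  then have *: "\<forall>a\<in>parcs G. (case a of (u, v) \<Rightarrow> \<bar>indicator B u - indicator B v :: real\<bar>) = 0"
    by (subst (asm) sum_nonneg_eq_0_iff) (auto simp: pair_finite_arcs)
  have closed: "u \<in> B \<longleftrightarrow> v \<in> B" if "(u, v) \<in> (parcs G)\<^sup>s" for u v
    using that * by (auto simp: symcl_def indicator_def split: if_splits)
  obtain u v where uv: "u \<in> B" "u \<in> pverts G" "v \<in> pverts G" "v \<notin> B" using B by auto
  then have "(u, v) \<in> rtrancl_on (pverts G) ((parcs G)\<^sup>s)"
    using conn by (simp add: connected_conv)
  then have "v \<in> B" using uv(1) by (induction rule: rtrancl_on_induct) (auto simp: closed)
  with uv show False by simp
qed

lemma (in pair_graph) cut_pair:
  assumes "u \<noteq> v"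
  shows "edge_variation G (indicator {u, v}) =
    edge_variation G (indicator {u}) + edge_variation G (indicator {v}) -
      (if (u, v) \<in> parcs G then 2 else 0)"
proof -
  have vu: "(v, u) \<in> parcs G \<longleftrightarrow> (u, v) \<in> parcs G"
    using pair_sym_arcs by (auto simp: symmetric_def dest: symD)
  have pointwise: "\<bar>indicator {u, v} a - indicator {u, v} b :: real\<bar> =
      \<bar>indicator {u} a - indicator {u} b\<bar> + \<bar>indicator {v} a - indicator {v} b\<bar> -
        ((if (u, v) = (a, b) then 2 else 0) + (if (v, u) = (a, b) then 2 else 0))" for a b
    using assms by (cases "a = u"; cases "a = v"; cases "b = u"; cases "b = v"; simp)
  have "(\<Sum>(a, b)\<in>parcs G. \<bar>indicator {u, v} a - indicator {u, v} b :: real\<bar>) =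
      (\<Sum>(a, b)\<in>parcs G. \<bar>indicator {u} a - indicator {u} b\<bar> + \<bar>indicator {v} a - indicator {v} b\<bar> -
        ((if (u, v) = (a, b) then 2 else 0) + (if (v, u) = (a, b) then 2 else 0)))"
    by (intro sum.cong refl) (clarify, rule pointwise)
  also have "\<dots> = (\<Sum>(a, b)\<in>parcs G. \<bar>indicator {u} a - indicator {u} b\<bar>) +
      (\<Sum>(a, b)\<in>parcs G. \<bar>indicator {v} a - indicator {v} b\<bar>) -
      (if (u, v) \<in> parcs G then 4 else 0)"
    using vu pair_finite_arcs by (simp add: case_prod_unfold sum.distrib sum_subtractf del: prod.inject)
  finally show ?thesis by (simp add: edge_variation_def)
qed

section \<open>Complete graphs\<close>

lemma card_distinct_pairs:
  assumes "finite V"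
  shows "card {(u, v). u \<in> V \<and> v \<in> V \<and> u \<noteq> v} = card V * card V - card V"
proof -
  have "{(u, v). u \<in> V \<and> v \<in> V \<and> u \<noteq> v} = V \<times> V - Id_on V" by auto
  moreover have "card (Id_on V) = card V"
    using card_image[of "\<lambda>v. (v, v)" V]
    by (simp add: inj_on_def Id_on_def UNION_singleton_eq_range)
  ultimately show ?thesis using assms
    by (simp add: card_Diff_subset finite_subset[of "Id_on V" "V \<times> V"] Id_on_subset_Times card_cartesian_product)
qed

lemma (in pair_digraph) digraph_iso_complete_graph:
  "digraph_iso (with_proj G) (with_proj (complete_graph (card (pverts G)))) \<longleftrightarrow>
    parcs G = {(u, v). u \<in> pverts G \<and> v \<in> pverts G \<and> u \<noteq> v}"
  (is "?iso \<longleftrightarrow> parcs G = ?K")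
proof
  let ?n = "card (pverts G)"
  assume ?iso
  then obtain f where f: "digraph_isomorphism f"
      "with_proj (complete_graph ?n) = app_iso f (with_proj G)"
    by (auto simp: digraph_iso_def)
  have "parcs (complete_graph ?n) = iso_arcs f ` parcs G"
    using arg_cong[OF f(2), of arcs] by simp
  moreover have "inj_on (iso_arcs f) (parcs G)"
    using f(1) by (simp add: digraph_isomorphism_def)
  ultimately have "card (parcs G) = card (parcs (complete_graph ?n))"
    by (simp add: card_image)
  also have "\<dots> = card ?K"
    using card_distinct_pairs[of "{..<?n}"] card_distinct_pairs[OF pair_finite_verts]
    by (simp add: complete_graph_def)
  finally have card: "card (parcs G) = card ?K" .
  have "?K \<subseteq> pverts G \<times> pverts G" by auto
  then have "finite ?K" using pair_finite_verts by (meson finite_SigmaI finite_subset)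
  then show "parcs G = ?K"
    by (rule card_subset_eq) (use card in \<open>auto dest: wellformed' pair_no_loops\<close>)
next
  let ?n = "card (pverts G)"
  assume K: "parcs G = ?K"
  obtain h where h: "bij_betw h (pverts G) {..<?n}"
    using pair_finite_verts finite_same_card_bij[of "pverts G" "{..<?n}"] by auto
  then have inj: "inj_on h (pverts G)" and img: "h ` pverts G = {..<?n}"
    by (auto simp: bij_betw_def)
  define f :: "('a, 'a \<times> 'a, nat, nat \<times> nat) digraph_isomorphism" where
    "f = \<lparr>iso_verts = h, iso_arcs = map_prod h h, iso_head = snd, iso_tail = fst\<rparr>"
  have "digraph_isomorphism f"
    using inj by (auto simp: digraph_isomorphism_def f_def K inj_on_def intro: wf_digraph_axioms)
  moreover have "map_prod h h ` ?K = {(i, j). i < ?n \<and> j < ?n \<and> i \<noteq> j}"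
  proof (intro equalityI subsetI)
    fix a assume "a \<in> {(i, j). i < ?n \<and> j < ?n \<and> i \<noteq> j}"
    then obtain i j where ij: "a = (i, j)" "i \<in> h ` pverts G" "j \<in> h ` pverts G" "i \<noteq> j"
      by (auto simp: img)
    then obtain u v where "u \<in> pverts G" "v \<in> pverts G" "i = h u" "j = h v" by auto
    with ij show "a \<in> map_prod h h ` ?K" by (intro image_eqI[of _ _ "(u, v)"]) auto
  qed (use inj img in \<open>auto dest: inj_onD\<close>)
  then have "with_proj (complete_graph ?n) = app_iso f (with_proj G)"
    by (simp add: f_def app_iso_def with_proj_def complete_graph_def K img)
  ultimately show ?iso by (auto simp: digraph_iso_def)
qed

section \<open>The bounds\<close>

theorem theorem3p3:
  fixes G :: "'a pair_pre_digraph" and n :: nat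
  assumes "pair_graph G"
    and "Digraph_Component.connected (with_proj G)"
    and "card (pverts G) = n"
    and "n \<ge> 2"
  shows "1 / 2 < l1_fiedler G + l1_fiedler (complement_graph G)
    \<and> l1_fiedler G + l1_fiedler (complement_graph G) \<le> real n / 2
    \<and> (l1_fiedler G + l1_fiedler (complement_graph G) = real n / 2
         \<longleftrightarrow> digraph_iso (with_proj G) (with_proj (complete_graph n)))"
proof -
  interpret pair_graph G by fact
  interpret C: pair_fin_digraph "complement_graph G" by (rule pair_fin_digraph_complement)
  let ?V = "pverts G" and ?b = "l1_fiedler G" and ?c = "l1_fiedler (complement_graph G)"
  let ?cut = "\<lambda>A. edge_variation G (indicator A)"
  note conn = assms(2) and n = assms(3,4)
  have nG: "2 \<le> card ?V" "2 \<le> card (pverts (complement_graph G))" using n by simp_all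

  obtain A B where AB: "A \<noteq> {}" "A \<subseteq> ?V" "B \<noteq> {}" "B \<subseteq> ?V" "A \<inter> B = {}"
      "card A \<le> card B" and b: "?b = (cut_ratio G A + cut_ratio G B) / 2"
    using l1_fiedler_two_sets(1)[OF nG(1)] by blast
  obtain C D where CD: "C \<noteq> {}" "C \<subseteq> ?V" "D \<noteq> {}" "D \<subseteq> ?V" "C \<inter> D = {}" "card C \<le> card D"
    and c: "?c = (cut_ratio (complement_graph G) C + cut_ratio (complement_graph G) D) / 2"
    using C.l1_fiedler_two_sets(1)[OF nG(2)] unfolding complement_graph_simps by blast
  have disjoint_card: "card S + card T \<le> n" if "S \<subseteq> ?V" "T \<subseteq> ?V" "S \<inter> T = {}" for S T
    using that n pair_finite_verts card_mono[of ?V "S \<union> T"]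
    by (metis Un_least card_Un_disjoint finite_subset)

  have lower: "1 / 2 < ?b + ?c"
  proof -
    have "1 \<le> cut_ratio G A + cut_ratio (complement_graph G) C"
      using AB CD disjoint_card[of A B] disjoint_card[of C D] n
      by (intro cut_ratio_complement) auto
    moreover have "0 < cut_ratio G B"
    proof -
      have "0 < card B" using AB pair_finite_verts by (auto simp: card_gt_0_iff intro: finite_subset)
      moreover have "0 < ?cut B" using AB by (intro cut_pos_if_connected[OF conn]) auto
      ultimately show ?thesis by (simp add: cut_ratio_def)
    qed
    ultimately show ?thesis
      using cut_ratio_nonneg[of "complement_graph G" D] b c by argo
  qed

  have cut_bounds: "?b \<le> ?cut S * real n / (2 * real (card S) * (real n - real (card S)))"
    "?b + ?c \<le> ?b - ?cut S * real n / (2 * real (card S) * (real n - real (card S))) + real n / 2"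
    if S: "S \<noteq> {}" "S \<subset> ?V" for S
  proof -
    let ?d = "real (card S) * (real n - real (card S))"
    have "0 < card S" "card S < n"
      using S n pair_finite_verts psubset_card_mono[OF pair_finite_verts S(2)]
      by (auto simp: card_gt_0_iff intro: finite_subset)
    then have "0 < ?d" by simp
    have "?c \<le> edge_variation (complement_graph G) (indicator S) * real n / (2 * ?d)"
      using C.l1_fiedler_le_cut[of S] S n by (simp add: mult.assoc)
    also have "edge_variation (complement_graph G) (indicator S) = ?d - ?cut S"
      using cut_complement[of S] S n by auto
    also have "(?d - ?cut S) * real n / (2 * ?d) = real n / 2 - ?cut S * real n / (2 * ?d)"
    proof -
      have "(d - k) * real n / (2 * d) = real n / 2 - k * real n / (2 * d)" if "0 < d" for d k :: real
        using that by (simp add: field_simps)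
      then show ?thesis using \<open>0 < ?d\<close> .
    qed
    finally show "?b + ?c \<le> ?b - ?cut S * real n / (2 * real (card S) * (real n - real (card S))) + real n / 2"
      by (simp add: mult.assoc)
    show "?b \<le> ?cut S * real n / (2 * real (card S) * (real n - real (card S)))"
      using l1_fiedler_le_cut[of S] S n by simp
  qed

  obtain w where w: "w \<in> ?V" using AB by auto
  have singleton: "{u} \<subset> ?V" if "u \<in> ?V" for u
  proof -
    have "card {u} \<noteq> card ?V" using n by simp
    then show ?thesis using that by (metis empty_subsetI insert_subset psubsetI)
  qed
  have upper: "?b + ?c \<le> real n / 2"
    using cut_bounds[of "{w}"] singleton[OF w] by simp

  have "?b + ?c = real n / 2 \<longleftrightarrow> parcs G = {(u, v). u \<in> ?V \<and> v \<in> ?V \<and> u \<noteq> v}"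
  proof
    assume eq: "?b + ?c = real n / 2"
    have cut: "?cut S = ?b * (2 * real (card S) * (real n - real (card S))) / real n"
      if "S \<noteq> {}" "S \<subset> ?V" for S
    proof -
      have "?b = ?cut S * real n / (2 * real (card S) * (real n - real (card S)))"
        using cut_bounds[OF that] eq by linarith
      moreover have "0 < card S" "card S < n"
        using that n pair_finite_verts psubset_card_mono[OF pair_finite_verts that(2)]
        by (auto simp: card_gt_0_iff intro: finite_subset)
      ultimately show ?thesis by (simp add: field_simps)
    qed
    obtain s t where st: "(s, t) \<in> parcs G"
    proof -
      have "parcs G \<noteq> {}"
        using cut_pos_if_connected[OF conn _ singleton[OF w]] by (auto simp: edge_variation_def)
      then show thesis using that by auto
    qed
    then have st': "s \<in> ?V" "t \<in> ?V" "s \<noteq> t" by (auto dest: wellformed' pair_no_loops)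
    have "(u, v) \<in> parcs G" if uv: "u \<in> ?V" "v \<in> ?V" "u \<noteq> v" for u v
    proof (cases "n = 2")
      case True
      have "{a, b} = ?V" if "a \<in> ?V" "b \<in> ?V" "a \<noteq> b" for a b
        by (rule card_subset_eq) (use True that n pair_finite_verts in auto)
      then have "{u, v} = ?V" "{s, t} = ?V" using uv st' by simp_all
      then have "(u, v) = (s, t) \<or> (u, v) = (t, s)" using uv by auto
      then show ?thesis using st pair_sym_arcs by (auto simp: symmetric_def dest: symD)
    next
      case False
      then have "{u, v} \<noteq> ?V" "{s, t} \<noteq> ?V"
        using uv(3) st'(3) n card_2_iff[of ?V] by metis+
      then have "?cut {u, v} = ?cut {s, t}" "?cut {u} = ?cut {s}" "?cut {v} = ?cut {t}"
        using uv st' singleton by (simp_all add: cut psubset_eq)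
      then show ?thesis
        using cut_pair[OF uv(3)] cut_pair[OF st'(3)] st by (auto split: if_splits)
    qed
    then show "parcs G = {(u, v). u \<in> ?V \<and> v \<in> ?V \<and> u \<noteq> v}"
      by (auto dest: wellformed' pair_no_loops)
  next
    assume K: "parcs G = {(u, v). u \<in> ?V \<and> v \<in> ?V \<and> u \<noteq> v}"
    then have "parcs (complement_graph G) = {}" by (auto simp: complement_graph_def)
    then have "edge_variation (complement_graph G) x = 0" for x by (simp add: edge_variation_def)
    then have "?cut S = real (card S) * (real n - real (card S))" if "S \<subseteq> ?V" for S
      using cut_complement[OF that] n by simp
    moreover have "0 < card A" "0 < card B"
      using AB pair_finite_verts by (auto simp: card_gt_0_iff intro: finite_subset)
    ultimately have "cut_ratio G A = real n - real (card A)" "cut_ratio G B = real n - real (card B)"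
      using AB by (auto simp: cut_ratio_def)
    then have "real n / 2 \<le> ?b"
      using disjoint_card[OF AB(2,4,5)] by (simp add: b)
    then show "?b + ?c = real n / 2"
      using upper C.l1_fiedler_nonneg[OF nG(2)] by linarith
  qed
  then show ?thesis
    using lower upper digraph_iso_complete_graph n by simp
qed

end
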